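(* Let $\mathscr D=([n],\mathcal J)$ be a discrete polymatroid, and let $\omega:[n]\to\mathbb R_{>0}$ be a positive weight function. For every $t\in[0,1]$ and every $1\le k<\mathrm{rk}(\mathscr D)$, we have $$\mathrm J_{\omega,t}(k)^2\ \ge\ \Bigl(1+\frac1k\Bigr)\Bigl(1+\frac{1-t}{p(k-1)-1+t}\Bigr)\,\mathrm J_{\omega,t}(k-1)\,\mathrm J_{\omega,t}(k+1).$$ (In the degenerate case $t=0$, $p(k-1)=1$, one has $\mathrm J_{\omega,0}(k+1)=0$ and the right-hand side is read as $0$.)
   Context: A discrete polymatroid $\mathscr D=([n],\mathcal J)$ consists of $[n]=\{1,\dots,n\}$ and a nonempty finite set $\mathcal J\subset\mathbb N^n$ (with $0\in\mathbb N$) such that: (hereditary) $a\in\mathcal J$, $b\in\mathbb N^n$, $b\le a$ componentwise imply $b\in\mathcal J$; (exchange) $a,b\in\mathcal J$, $|a|<|b|$ imply there is $i\in[n]$ with $a_i<b_i$ and $a+e_i\in\mathcal J$. Here $|a|=a_1+\dots+a_n$ and $e_1,\dots,e_n$ is the standard basis. $\mathrm{rk}(\mathscr D)=\max\{|a|:a\in\mathcal J\}$ and $\mathcal J_k=\{a\in\mathcal J:|a|=k\}$. Put $\omega(a)=\prod_i\omega(i)^{a_i}$, $a!=\prod_i a_i!$, $\pi(a)=\sum_{i=1}^n\binom{a_i}{2}$, and $$\mathrm J_{\omega,t}(k)=\sum_{a\in\mathcal J_k}t^{\pi(a)}\,\frac{\omega(a)}{a!}\qquad(0^0=1).$$ For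 $a\in\mathcal J$ let $\mathrm{Cont}(a)=\{i\in[n]:a+e_i\in\mathcal J\}$; for $i,j\in\mathrm{Cont}(a)$ write $i\sim_a j$ if $i=j$ or $a+e_i+e_j\notin\mathcal J$. This is an equivalence relation on $\mathrm{Cont}(a)$; $\mathrm{Par}(a)$ is the set of its equivalence classes. For $0\le k<\mathrm{rk}(\mathscr D)$, $p(k)=\max\{|\mathrm{Par}(a)|:a\in\mathcal J_k\}$. *)

theory Defs
  imports Complex_Main
begin

(* A vector a of N^n is a function nat => nat whose support lies in {1..n}. *)

definition nat_vecs :: "nat \<Rightarrow> (nat \<Rightarrow> nat) set" where
  "nat_vecs n = {a. \<forall>i. i \<notin> {1..n} \<longrightarrow> a i = 0}"

definition vec_size :: "nat \<Rightarrow> (nat \<Rightarrow> nat) \<Rightarrow> nat" where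
  "vec_size n a = (\<Sum>i=1..n. a i)"

definition add_unit :: "(nat \<Rightarrow> nat) \<Rightarrow> nat \<Rightarrow> (nat \<Rightarrow> nat)"  (* a + e_i *) where
  "add_unit a i = a(i := a i + 1)"

locale discrete_polymatroid =
  fixes n :: nat and J :: "(nat \<Rightarrow> nat) set"
  assumes subset_vecs: "J \<subseteq> nat_vecs n"
    and finite_J: "finite J"
    and nonempty: "J \<noteq> {}"
    and hereditary: "\<lbrakk>a \<in> J; b \<in> nat_vecs n; b \<le> a\<rbrakk> \<Longrightarrow> b \<in> J"
    and exchange: "\<lbrakk>a \<in> J; b \<in> J; vec_size n a < vec_size n b\<rbrakk>
      \<Longrightarrow> \<exists>i\<in>{1..n}. a i < b i \<and> add_unit a i \<in> J"

definition rk :: "nat \<Rightarrow> (nat \<Rightarrow> nat) set \<Rightarrow> nat" where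
  "rk n J = Max (vec_size n ` J)"

definition level :: "nat \<Rightarrow> (nat \<Rightarrow> nat) set \<Rightarrow> nat \<Rightarrow> (nat \<Rightarrow> nat) set" where
  "level n J k = {a \<in> J. vec_size n a = k}"

definition vec_weight :: "nat \<Rightarrow> (nat \<Rightarrow> real) \<Rightarrow> (nat \<Rightarrow> nat) \<Rightarrow> real" where
  "vec_weight n \<omega> a = (\<Prod>i=1..n. \<omega> i ^ a i)"

definition vec_fact :: "nat \<Rightarrow> (nat \<Rightarrow> nat) \<Rightarrow> nat" where
  "vec_fact n a = (\<Prod>i=1..n. fact (a i))"

definition vec_pi :: "nat \<Rightarrow> (nat \<Rightarrow> nat) \<Rightarrow> nat" where
  "vec_pi n a = (\<Sum>i=1..n. a i choose 2)"

definition level_sum ::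
  "nat \<Rightarrow> (nat \<Rightarrow> nat) set \<Rightarrow> (nat \<Rightarrow> real) \<Rightarrow> real \<Rightarrow> nat \<Rightarrow> real" where
  "level_sum n J \<omega> t k =
    (\<Sum>a\<in>level n J k. t ^ vec_pi n a * (vec_weight n \<omega> a / real (vec_fact n a)))"

definition Cont :: "nat \<Rightarrow> (nat \<Rightarrow> nat) set \<Rightarrow> (nat \<Rightarrow> nat) \<Rightarrow> nat set" where
  "Cont n J a = {i \<in> {1..n}. add_unit a i \<in> J}"

definition par_rel :: "nat \<Rightarrow> (nat \<Rightarrow> nat) set \<Rightarrow> (nat \<Rightarrow> nat) \<Rightarrow> (nat \<times> nat) set" where
  "par_rel n J a = {(i, j). i \<in> Cont n J a \<and> j \<in> Cont n J a \<and>
     (i = j \<or> add_unit (add_unit a i) j \<notin> J)}"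

definition Par :: "nat \<Rightarrow> (nat \<Rightarrow> nat) set \<Rightarrow> (nat \<Rightarrow> nat) \<Rightarrow> nat set set" where
  "Par n J a = Cont n J a // par_rel n J a"

(* For a discrete polymatroid, level n J k is finite, and nonempty when k <= rk n J, so this
   Max is a genuine maximum in the range k < rk n J where it is used. *)
definition max_par :: "nat \<Rightarrow> (nat \<Rightarrow> nat) set \<Rightarrow> nat \<Rightarrow> nat" where
  "max_par n J k = Max ((\<lambda>a. card (Par n J a)) ` level n J k)"

lemma add_unit_commute: "add_unit (add_unit a i) j = add_unit (add_unit a j) i"
  by (auto simp: add_unit_def fun_eq_iff)

lemma vec_size_add_unit:
  assumes "i \<in> {1..n}"
  shows "vec_size n (add_unit a i) = vec_size n a + 1"
proof -
  have "vec_size n (add_unit a i) = (\<Sum>j=1..n. a j + (if j = i then 1 else 0))"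
    unfolding vec_size_def add_unit_def by (rule sum.cong) auto
  also have "\<dots> = vec_size n a + 1"
    using assms by (simp add: sum.distrib vec_size_def)
  finally show ?thesis .
qed

lemma (in discrete_polymatroid) equiv_par_rel: "equiv (Cont n J a) (par_rel n J a)"
proof (rule equivI)
  show "par_rel n J a \<subseteq> Cont n J a \<times> Cont n J a"
    by (auto simp: par_rel_def)
  show "refl_on (Cont n J a) (par_rel n J a)"
    by (auto simp: refl_on_def par_rel_def)
  show "sym (par_rel n J a)"
    unfolding sym_def par_rel_def using add_unit_commute by auto
  show "trans (par_rel n J a)"
  proof (rule transI)
    fix i j k
    assume ij: "(i, j) \<in> par_rel n J a" and jk: "(j, k) \<in> par_rel n J a"
    show "(i, k) \<in> par_rel n J a"
    proof (rule ccontr)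
      assume neg: "(i, k) \<notin> par_rel n J a"
      have C: "i \<in> Cont n J a" "j \<in> Cont n J a" "k \<in> Cont n J a"
        using ij jk by (auto simp: par_rel_def)
      have ik: "i \<noteq> k" "add_unit (add_unit a i) k \<in> J"
        using neg C by (auto simp: par_rel_def)
      have ne: "i \<noteq> j" "j \<noteq> k" using neg ij jk by auto
      have "vec_size n (add_unit a j) < vec_size n (add_unit (add_unit a i) k)"
        using C by (simp add: vec_size_add_unit Cont_def)
      then obtain l where l: "add_unit a j l < add_unit (add_unit a i) k l"
          "add_unit (add_unit a j) l \<in> J"
        using exchange[of "add_unit a j" "add_unit (add_unit a i) k"] C ik
        by (auto simp: Cont_def)
      have "l = i \<or> l = k"
        using l(1) ik ne by (auto simp: add_unit_def split: if_splits)
      then show False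
        using l(2) ij jk ne add_unit_commute[of a i j] by (auto simp: par_rel_def)
    qed
  qed
qed

end

theory Submission
  imports Defs "HOL-Analysis.Convex"
begin

text \<open>
  Say that a symmetric matrix is hyperbolic if it satisfies the reversed Cauchy-Schwarz
  inequality. Adjoin a direction 0 that leaves a vector unchanged, and for a weight g on J form
  the matrix whose (i, j) entry sums g over all words of length m extending a + e_i + e_j. The
  word sums of three consecutive lengths from the zero vector are values of this matrix on two
  test vectors, so log-concavity of the word sums follows once the matrix is hyperbolic. The
  matrix for m + 1 is a positive combination of those for m, whose products with the combining
  vector are its rows; this lets hyperbolicity propagate from m = 0. There it reduces to
  Cauchy-Schwarz over the classes of Par(a), and the weights of the top level may be scaled by
  p / (p - 1 + t) without losing it, which is the extra factor in the theorem. A small positive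
  weight on direction 0 makes everything connected; it is sent to 0 at the end.
\<close>

subsection \<open>Hyperbolic matrices\<close>

definition mv :: "'a set \<Rightarrow> ('a \<Rightarrow> 'a \<Rightarrow> real) \<Rightarrow> ('a \<Rightarrow> real) \<Rightarrow> 'a \<Rightarrow> real" where
  "mv I H v i = (\<Sum>j\<in>I. H i j * v j)"

definition bilin :: "'a set \<Rightarrow> ('a \<Rightarrow> 'a \<Rightarrow> real) \<Rightarrow> ('a \<Rightarrow> real) \<Rightarrow> ('a \<Rightarrow> real) \<Rightarrow> real" where
  "bilin I H u v = (\<Sum>i\<in>I. u i * mv I H v i)"

definition sym_matrix :: "'a set \<Rightarrow> ('a \<Rightarrow> 'a \<Rightarrow> real) \<Rightarrow> bool" where
  "sym_matrix I H \<longleftrightarrow> (\<forall>i\<in>I. \<forall>j\<in>I. H i j = H j i)"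

text \<open>For a symmetric matrix on a finite index set this is equivalent to having at most one
  positive eigenvalue. Where the form is negative at \<open>v\<close> the inequality is trivial, so
  only \<open>u\<close> carries a sign condition.\<close>

definition hyperbolic_on :: "'a set \<Rightarrow> ('a \<Rightarrow> 'a \<Rightarrow> real) \<Rightarrow> bool" where
  "hyperbolic_on I H \<longleftrightarrow>
    (\<forall>u v. 0 \<le> bilin I H u u \<longrightarrow> bilin I H u u * bilin I H v v \<le> (bilin I H u v)\<^sup>2)"

lemma mv_diff_scale: "mv I H (\<lambda>i. u i - c * v i) i = mv I H u i - c * mv I H v i"
  by (simp add: mv_def sum_subtractf sum_distrib_left algebra_simps)

lemma bilin_diff_scale_left:
  "bilin I H (\<lambda>i. u i - c * v i) w = bilin I H u w - c * bilin I H v w"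
  by (simp add: bilin_def sum_subtractf sum_distrib_left algebra_simps)

lemma bilin_diff_scale_right:
  "bilin I H w (\<lambda>i. u i - c * v i) = bilin I H w u - c * bilin I H w v"
  by (simp add: bilin_def mv_diff_scale sum_subtractf sum_distrib_left algebra_simps)

lemma bilin_commute:
  assumes "sym_matrix I H"
  shows "bilin I H u v = bilin I H v u"
proof -
  have "bilin I H u v = (\<Sum>i\<in>I. \<Sum>j\<in>I. u i * (H i j * v j))"
    by (simp add: bilin_def mv_def sum_distrib_left)
  also have "\<dots> = (\<Sum>j\<in>I. \<Sum>i\<in>I. u i * (H i j * v j))" by (rule sum.swap)
  also have "\<dots> = (\<Sum>j\<in>I. \<Sum>i\<in>I. v j * (H j i * u i))"
    using assms by (intro sum.cong refl) (simp add: sym_matrix_def)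
  also have "\<dots> = bilin I H v u"
    by (simp add: bilin_def mv_def sum_distrib_left)
  finally show ?thesis .
qed

text \<open>If the form is positive at \<open>u\<close>, then \<open>u\<close> is not orthogonal to
  \<open>w\<close>, and some \<open>v - c * u\<close> is. The form is nonpositive there, so a
  quadratic polynomial in \<open>c\<close> with positive leading coefficient has a nonpositive
  value; its discriminant is therefore nonnegative, which is the claim.\<close>

lemma hyperbolic_onI:
  assumes sym: "sym_matrix I H"
    and neg: "\<And>v. bilin I H v w = 0 \<Longrightarrow> bilin I H v v \<le> 0"
  shows "hyperbolic_on I H"
  unfolding hyperbolic_on_def
proof (intro allI impI)
  fix u v
  let ?U = "bilin I H u u" and ?V = "bilin I H v v" and ?B = "bilin I H u v"
  assume U: "0 \<le> ?U"
  show "?U * ?V \<le> ?B\<^sup>2"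
  proof (cases "?U = 0")
    case False
    with U have U: "?U > 0" by simp
    then have nz: "bilin I H u w \<noteq> 0" using neg[of u] by auto
    define c where "c = bilin I H v w / bilin I H u w"
    have "bilin I H (\<lambda>i. v i - c * u i) w = 0"
      unfolding bilin_diff_scale_left using nz by (simp add: c_def)
    from neg[OF this] have "?V - 2 * c * ?B + c\<^sup>2 * ?U \<le> 0"
      by (simp add: bilin_diff_scale_left bilin_diff_scale_right bilin_commute[OF sym, of v u]
          power2_eq_square algebra_simps)
    then have "?U * (?V - 2 * c * ?B + c\<^sup>2 * ?U) \<le> 0"
      using U by (simp add: mult_le_0_iff)
    moreover have "0 \<le> (c * ?U - ?B)\<^sup>2" by simp
    ultimately show ?thesis by (simp add: power2_eq_square algebra_simps)
  qed simp
qed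

section \<open>Weighted Laplacians, positive definite systems, nonpositivity on a complement\<close>

text \<open>The left side is the energy of a graph Laplacian in the rescaled variables
  \<open>z i / x i\<close>, with edge weights \<open>H i j * x i * x j\<close>. Expanding the
  squares yields the diagonal sum twice, by symmetry of \<open>H\<close>.\<close>

lemma laplacian_sum_of_squares:
  assumes sym: "sym_matrix I H" and pos: "\<And>i. i \<in> I \<Longrightarrow> 0 < x i"
  shows "(\<Sum>i\<in>I. mv I H x i / x i * (z i)\<^sup>2) - bilin I H z z =
    (\<Sum>i\<in>I. \<Sum>j\<in>I. H i j * x i * x j * (z i / x i - z j / x j)\<^sup>2) / 2"
proof -
  let ?D = "\<Sum>i\<in>I. mv I H x i / x i * (z i)\<^sup>2"
  have D: "?D = (\<Sum>i\<in>I. \<Sum>j\<in>I. H i j * x j * (z i)\<^sup>2 / x i)"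
    by (simp add: mv_def sum_distrib_right sum_divide_distrib)
  have "?D = (\<Sum>j\<in>I. \<Sum>i\<in>I. H j i * x i * (z j)\<^sup>2 / x j)" by (rule D)
  also have "\<dots> = (\<Sum>i\<in>I. \<Sum>j\<in>I. H j i * x i * (z j)\<^sup>2 / x j)" by (rule sum.swap)
  also have "\<dots> = (\<Sum>i\<in>I. \<Sum>j\<in>I. H i j * x i * (z j)\<^sup>2 / x j)"
    using sym by (intro sum.cong refl) (simp add: sym_matrix_def)
  finally have D': "?D = (\<Sum>i\<in>I. \<Sum>j\<in>I. H i j * x i * (z j)\<^sup>2 / x j)" .
  have B: "bilin I H z z = (\<Sum>i\<in>I. \<Sum>j\<in>I. H i j * z i * z j)"
    by (simp add: bilin_def mv_def sum_distrib_left mult_ac)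
  have "(\<Sum>i\<in>I. \<Sum>j\<in>I. H i j * x i * x j * (z i / x i - z j / x j)\<^sup>2) =
    (\<Sum>i\<in>I. \<Sum>j\<in>I. H i j * x j * (z i)\<^sup>2 / x i + H i j * x i * (z j)\<^sup>2 / x j
       - 2 * (H i j * z i * z j))"
  proof (intro sum.cong refl)
    fix i j assume "i \<in> I" "j \<in> I"
    then have "x i \<noteq> 0" "x j \<noteq> 0" using pos by fastforce+
    then show "H i j * x i * x j * (z i / x i - z j / x j)\<^sup>2 =
      H i j * x j * (z i)\<^sup>2 / x i + H i j * x i * (z j)\<^sup>2 / x j - 2 * (H i j * z i * z j)"
      by (simp add: field_simps power2_eq_square)
  qed
  also have "\<dots> = ?D + ?D - 2 * bilin I H z z"
    unfolding B by (subst (1) D, subst D')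
      (simp add: sum.distrib sum_subtractf sum_distrib_left)
  finally show ?thesis by simp
qed

lemma bilin_le_laplacian:
  assumes "sym_matrix I H" "\<And>i. i \<in> I \<Longrightarrow> 0 < x i" "\<And>i j. i \<in> I \<Longrightarrow> j \<in> I \<Longrightarrow> 0 \<le> H i j"
  shows "bilin I H z z \<le> (\<Sum>i\<in>I. mv I H x i / x i * (z i)\<^sup>2)"
proof -
  have "0 \<le> (\<Sum>i\<in>I. \<Sum>j\<in>I. H i j * x i * x j * (z i / x i - z j / x j)\<^sup>2)"
    using assms by (intro sum_nonneg mult_nonneg_nonneg) (auto intro: less_imp_le)
  with laplacian_sum_of_squares[OF assms(1), of x z] assms(2) show ?thesis by auto
qed

text \<open>Gaussian elimination by induction on the index set. After eliminating \<open>p\<close>,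
  the remaining system has the Schur complement \<open>A'\<close> of \<open>A p p\<close> as its
  matrix, and this is again positive definite.\<close>

lemma positive_definite_solvable:
  assumes "finite I" "sym_matrix I A"
    and "\<And>y. (\<exists>i\<in>I. y i \<noteq> 0) \<Longrightarrow> 0 < bilin I A y y"
  shows "\<exists>u. \<forall>i\<in>I. mv I A u i = b i"
  using assms
proof (induction I arbitrary: A b rule: finite_induct)
  case empty
  then show ?case by simp
next
  case (insert p I)
  have sym: "A i j = A j i" if "i \<in> insert p I" "j \<in> insert p I" for i j
    using insert.prems(1) that by (auto simp: sym_matrix_def)
  have upd: "(\<Sum>j\<in>I. A i j * (y(p := c)) j) = (\<Sum>j\<in>I. A i j * y j)" for i y c
    using insert.hyps by (intro sum.cong) auto
  have mv_ins: "mv (insert p I) A (y(p := c)) i = A i p * c + mv I A y i" for y c i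
    using insert.hyps by (simp add: mv_def upd del: fun_upd_apply) simp
  have app: "A p p > 0"
  proof -
    have "0 < bilin (insert p I) A ((\<lambda>_. 0)(p := 1)) ((\<lambda>_. 0)(p := 1))"
      by (rule insert.prems(2)) auto
    also have "\<dots> = A p p"
    proof -
      have "(\<Sum>i\<in>I. ((\<lambda>_. 0::real)(p := 1)) i * A i p) = 0"
        using insert.hyps by (intro sum.neutral) auto
      then show ?thesis
        using insert.hyps unfolding bilin_def mv_ins by (simp add: mv_def)
    qed
    finally show ?thesis .
  qed
  define A' where "A' i j = A i j - A i p * A p j / A p p" for i j
  have mv': "mv I A' y i = mv I A y i - A i p * mv I A y p / A p p" for y i
    by (simp add: mv_def A'_def sum_subtractf left_diff_distrib sum_distrib_left sum_divide_distrib
        mult.assoc)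
  have "\<exists>u. \<forall>i\<in>I. mv I A' u i = b i - A i p * b p / A p p"
  proof (rule insert.IH)
    show "sym_matrix I A'" using sym by (auto simp: sym_matrix_def A'_def)
    fix y :: "'a \<Rightarrow> real" assume y: "\<exists>i\<in>I. y i \<noteq> 0"
    \<comment> \<open>With this entry at \<open>p\<close>, row \<open>p\<close> of \<open>A\<close>
      annihilates the extended vector, so the form of \<open>A\<close> there equals the form of
      \<open>A'\<close> at \<open>y\<close>.\<close>
    define c where "c = - mv I A y p / A p p"
    have "0 < bilin (insert p I) A (y(p := c)) (y(p := c))"
      using y insert.hyps by (intro insert.prems(2)) auto
    also have "\<dots> = (\<Sum>i\<in>I. y i * (A i p * c + mv I A y i))"
    proof -
      have "A p p * c + mv I A y p = 0" using app by (simp add: c_def)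
      moreover have "(\<Sum>i\<in>I. (y(p := c)) i * (A i p * c + mv I A y i)) =
          (\<Sum>i\<in>I. y i * (A i p * c + mv I A y i))"
        using insert.hyps by (intro sum.cong) auto
      ultimately show ?thesis
        unfolding bilin_def mv_ins using insert.hyps by (simp del: fun_upd_apply)
    qed
    also have "\<dots> = bilin I A' y y"
      unfolding bilin_def mv' by (intro sum.cong) (auto simp: c_def)
    finally show "0 < bilin I A' y y" .
  qed
  then obtain u where u: "\<And>i. i \<in> I \<Longrightarrow> mv I A' u i = b i - A i p * b p / A p p" by blast
  define c where "c = (b p - mv I A u p) / A p p"
  have "mv (insert p I) A (u(p := c)) i = b i" if "i \<in> insert p I" for i
  proof (cases "i = p")
    case True
    then show ?thesis using app by (simp add: mv_ins c_def)
  next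
    case False
    then show ?thesis using u[of i] that app unfolding mv' mv_ins c_def
      by (simp add: field_simps)
  qed
  then show ?case by blast
qed


text \<open>
  In the inner product weighted by d = H x / x, let M be H with row i divided by d i. The
  hypothesis on all v says M \<le> M^2, and M \<le> 1 always holds. Writing v = (1 - M) u, which is
  possible since v is orthogonal to x, the form at v is (M - M^2) at u plus (M - 1) at M u.
\<close>

lemma bilin_nonpos_on_complement:
  assumes fin: "finite I" and o: "o' \<in> I" and sym: "sym_matrix I H"
    and x: "\<And>i. i \<in> I \<Longrightarrow> 0 < x i"
    and nonneg: "\<And>i j. i \<in> I \<Longrightarrow> j \<in> I \<Longrightarrow> 0 \<le> H i j"
    and star: "\<And>i j. i \<in> I \<Longrightarrow> j \<in> I \<Longrightarrow> H o' i = 0 \<Longrightarrow> H i j = 0"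
    and sq: "\<And>v. bilin I H v v \<le> (\<Sum>i\<in>I. x i * (mv I H v i)\<^sup>2 / mv I H x i)"
    and orth: "bilin I H v x = 0"
  shows "bilin I H v v \<le> 0"
proof -
  define d where "d i = mv I H x i / x i" for i
  have zero_row: "mv I H y i = 0" if "i \<in> I" "H o' i = 0" for y i
    using star that by (simp add: mv_def)
  have mv_pos: "0 < mv I H x i" if "i \<in> I" "H o' i \<noteq> 0" for i
    unfolding mv_def
  proof (rule sum_pos2[OF fin o])
    have "H i o' = H o' i" "0 \<le> H o' i" using sym o that(1) nonneg by (auto simp: sym_matrix_def)
    then show "0 < H i o' * x o'" using that x[OF o] by auto
  qed (use that x nonneg in \<open>auto intro!: mult_nonneg_nonneg intro: less_imp_le\<close>)
  have d_iff: "d i = 0 \<longleftrightarrow> H o' i = 0" if "i \<in> I" for i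
    using zero_row[OF that, of x] mv_pos[OF that] x[OF that]
    by (cases "H o' i = 0") (auto simp: d_def)
  have d_x: "d i * x i = mv I H x i" if "i \<in> I" for i
    using x[OF that] by (simp add: d_def)
  \<comment> \<open>By \<open>star\<close>, indices with \<open>H o' i = 0\<close> have zero rows.
    All others are joined to \<open>o'\<close>, so the Laplacian degenerates only along
    \<open>x\<close>; prescribing the value 0 at \<open>o'\<close> makes it positive
    definite.\<close>
  define C where "C = {i \<in> I. i \<noteq> o' \<and> H o' i \<noteq> 0}"
  have C: "C \<subseteq> I" "finite C" using fin by (auto simp: C_def)
  define A where "A i j = (if i = j then d i else 0) - H i j" for i j
  have mv_A: "mv C A y i = d i * y i - mv C H y i" if "i \<in> C" for y i
    using that C by (simp add: mv_def A_def left_diff_distrib sum_subtractf if_distrib[of "\<lambda>a. a * _"]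
        cong: if_cong)
  have ext: "mv C H y i = mv I H (\<lambda>j. if j \<in> C then y j else 0) i" for y i
    unfolding mv_def by (rule sum.mono_neutral_cong_left) (use fin C in auto)
  have "\<exists>u. \<forall>i\<in>C. mv C A u i = d i * v i"
  proof (rule positive_definite_solvable[OF C(2)])
    show "sym_matrix C A" using sym C by (auto simp: sym_matrix_def A_def)
    fix y :: "'a \<Rightarrow> real" assume "\<exists>i\<in>C. y i \<noteq> 0"
    then obtain j where j: "j \<in> C" "y j \<noteq> 0" by blast
    define y' where "y' = (\<lambda>i. if i \<in> C then y i else 0)"
    have "bilin C A y y = (\<Sum>i\<in>C. d i * (y i)\<^sup>2 - y i * mv C H y i)"
      unfolding bilin_def by (intro sum.cong refl) (simp add: mv_A algebra_simps power2_eq_square)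
    also have "\<dots> = (\<Sum>i\<in>I. d i * (y' i)\<^sup>2 - y' i * mv I H y' i)"
      by (rule sum.mono_neutral_cong_left) (use fin C in \<open>auto simp: y'_def ext\<close>)
    also have "\<dots> = (\<Sum>i\<in>I. \<Sum>j\<in>I. H i j * x i * x j * (y' i / x i - y' j / x j)\<^sup>2) / 2"
      using laplacian_sum_of_squares[of I H x y'] sym x
      by (simp add: sum_subtractf d_def bilin_def)
    also have "\<dots> > 0"
    proof -
      have nn: "0 \<le> H i j * x i * x j * (y' i / x i - y' j / x j)\<^sup>2" if "i \<in> I" "j \<in> I" for i j
        using that nonneg x by (intro mult_nonneg_nonneg) (auto intro: less_imp_le)
      \<comment> \<open>Since \<open>y'\<close> vanishes at \<open>o'\<close>, the single edge from
        \<open>o'\<close> to \<open>j\<close> already contributes a positive square.\<close>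
      have "0 < H o' j * x o' * x j * (y' o' / x o' - y' j / x j)\<^sup>2"
        using j nonneg[OF o, of j] x[OF o] x[of j] by (auto simp: C_def y'_def)
      then have "0 < (\<Sum>j\<in>I. H o' j * x o' * x j * (y' o' / x o' - y' j / x j)\<^sup>2)"
        using j C nn[OF o] by (intro sum_pos2[OF fin, of j]) auto
      then have "0 < (\<Sum>i\<in>I. \<Sum>j\<in>I. H i j * x i * x j * (y' i / x i - y' j / x j)\<^sup>2)"
        using nn
        by (intro sum_pos2[OF fin o, where f =
              "\<lambda>i. \<Sum>j\<in>I. H i j * x i * x j * (y' i / x i - y' j / x j)\<^sup>2"])
          (auto intro: sum_nonneg)
      then show ?thesis by simp
    qed
    finally show "0 < bilin C A y y" .
  qed
  then obtain u0 where u0: "\<And>i. i \<in> C \<Longrightarrow> mv C A u0 i = d i * v i" by blast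
  define u where "u = (\<lambda>i. if i \<in> C then u0 i else 0)"
  have solved': "d i * u i - mv I H u i = d i * v i" if "i \<in> I" "i \<noteq> o'" for i
  proof (cases "i \<in> C")
    case True
    then show ?thesis using u0[OF True] by (simp add: mv_A ext u_def)
  next
    case False
    then have "H o' i = 0" using that by (auto simp: C_def)
    then show ?thesis using zero_row[of i] d_iff[of i] that by simp
  qed
  \<comment> \<open>The equation at \<open>o'\<close> is still missing. The Laplacian is symmetric
    and kills \<open>x\<close>, and \<open>v\<close> is orthogonal to \<open>x\<close>, so the
    residuals weighted by \<open>x\<close> add up to 0. All but the one at \<open>o'\<close> are
    known to vanish, hence so does that one.\<close>
  have "(\<Sum>i\<in>I. x i * (d i * u i - mv I H u i - d i * v i)) = 0"
  proof -
    have eq: "(\<Sum>i\<in>I. x i * (d i * y i)) = bilin I H y x" for y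
      unfolding bilin_def by (intro sum.cong refl) (simp add: d_x[symmetric])
    have "(\<Sum>i\<in>I. x i * (d i * u i - mv I H u i - d i * v i)) =
      bilin I H u x - bilin I H x u - bilin I H v x"
      unfolding eq[symmetric] by (simp add: right_diff_distrib sum_subtractf bilin_def)
    then show ?thesis using orth bilin_commute[OF sym, of u x] by simp
  qed
  moreover have "(\<Sum>i\<in>I. x i * (d i * u i - mv I H u i - d i * v i)) =
      x o' * (d o' * u o' - mv I H u o' - d o' * v o')"
    using solved' by (subst sum.remove[OF fin o]) simp
  ultimately have solved: "d i * u i - mv I H u i = d i * v i" if "i \<in> I" for i
    using solved'[OF that] x[OF o] by (cases "i = o'") auto
  \<comment> \<open>This is M applied to \<open>u\<close>. Where \<open>d i = 0\<close>, division
    returns 0, consistent with the zero row.\<close>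
  define z where "z i = mv I H u i / d i" for i
  have dz: "d i * z i = mv I H u i" if "i \<in> I" for i
    using d_iff[OF that] zero_row[OF that] by (auto simp: z_def)
  \<comment> \<open>The factor 1 fits \<open>bilin_diff_scale_left\<close> and
    \<open>bilin_diff_scale_right\<close>. The vectors \<open>v\<close> and \<open>w\<close> may
    differ only on zero rows, which the form does not see.\<close>
  define w where "w i = u i - 1 * z i" for i
  have vw: "v i = w i" if "i \<in> I" "H o' i \<noteq> 0" for i
  proof -
    have "d i * v i = d i * w i" using solved[OF that(1)] dz[OF that(1)]
      by (simp add: w_def algebra_simps)
    then show ?thesis using d_iff that by simp
  qed
  have mv_vw: "mv I H v i = mv I H w i" if "i \<in> I" for i
    unfolding mv_def
  proof (intro sum.cong refl)
    fix j assume j: "j \<in> I"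
    have "H i j = H j i" using sym that j by (auto simp: sym_matrix_def)
    then show "H i j * v j = H i j * w j"
      using vw[OF j] star[OF j that] by (cases "H o' j = 0") auto
  qed
  have "bilin I H v v = bilin I H w w"
    unfolding bilin_def
  proof (intro sum.cong refl)
    fix i assume "i \<in> I"
    then show "v i * mv I H v i = w i * mv I H w i"
      using vw[of i] zero_row[of i] by (cases "H o' i = 0") (auto simp: mv_vw)
  qed
  also have "\<dots> = bilin I H u u - 2 * bilin I H z u + bilin I H z z"
    unfolding w_def bilin_diff_scale_left bilin_diff_scale_right
    using bilin_commute[OF sym, of u z] by simp
  also have "bilin I H z u = (\<Sum>i\<in>I. d i * (z i)\<^sup>2)"
    unfolding bilin_def by (intro sum.cong refl) (simp add: dz[symmetric] power2_eq_square)
  finally have "bilin I H v v = bilin I H u u - 2 * (\<Sum>i\<in>I. d i * (z i)\<^sup>2) + bilin I H z z" .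
  moreover have "bilin I H u u \<le> (\<Sum>i\<in>I. d i * (z i)\<^sup>2)"
  proof -
    have "(\<Sum>i\<in>I. x i * (mv I H u i)\<^sup>2 / mv I H x i) = (\<Sum>i\<in>I. d i * (z i)\<^sup>2)"
    proof (intro sum.cong refl)
      fix i assume i: "i \<in> I"
      then show "x i * (mv I H u i)\<^sup>2 / mv I H x i = d i * (z i)\<^sup>2"
        using x[OF i] by (simp add: dz[OF i, symmetric] d_x[OF i, symmetric] power2_eq_square)
    qed
    with sq[of u] show ?thesis by simp
  qed
  moreover have "bilin I H z z \<le> (\<Sum>i\<in>I. d i * (z i)\<^sup>2)"
    unfolding d_def by (rule bilin_le_laplacian[OF sym x nonneg])
  ultimately show ?thesis by simp
qed

section \<open>From local matrices to their combination\<close>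

text \<open>By \<open>row\<close>, hyperbolicity of \<open>K l\<close> at \<open>x\<close> and
  \<open>v\<close> bounds the form of \<open>K l\<close> at \<open>v\<close> by the square of
  \<open>mv I H v l\<close> over \<open>mv I H x l\<close>. Summing with weights \<open>x l\<close>
  gives the bound that \<open>bilin_nonpos_on_complement\<close> asks for, and \<open>x\<close> then
  serves as \<open>w\<close> in \<open>hyperbolic_onI\<close>.\<close>

lemma hyperbolic_local_to_global:
  assumes fin: "finite I" and o: "o' \<in> I"
    and x: "\<And>i. i \<in> I \<Longrightarrow> 0 < x i"
    and K: "\<And>l. l \<in> I \<Longrightarrow> hyperbolic_on I (K l)" "\<And>l. l \<in> I \<Longrightarrow> sym_matrix I (K l)"
      "\<And>l i j. l \<in> I \<Longrightarrow> i \<in> I \<Longrightarrow> j \<in> I \<Longrightarrow> 0 \<le> K l i j"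
    and H: "\<And>i j. i \<in> I \<Longrightarrow> j \<in> I \<Longrightarrow> H i j = (\<Sum>l\<in>I. x l * K l i j)"
    and row: "\<And>l i. l \<in> I \<Longrightarrow> i \<in> I \<Longrightarrow> mv I (K l) x i = H l i"
    and star: "\<And>i j. i \<in> I \<Longrightarrow> j \<in> I \<Longrightarrow> H o' i = 0 \<Longrightarrow> H i j = 0"
  shows "hyperbolic_on I H"
proof (rule hyperbolic_onI)
  show sym: "sym_matrix I H"
    unfolding sym_matrix_def
  proof (intro ballI)
    fix i j assume "i \<in> I" "j \<in> I"
    then show "H i j = H j i"
      using K(2) by (simp add: H) (intro sum.cong, auto simp: sym_matrix_def)
  qed
  have nonneg: "0 \<le> H i j" if "i \<in> I" "j \<in> I" for i j
    unfolding H[OF that] using that K(3) x by (intro sum_nonneg mult_nonneg_nonneg) (auto intro: less_imp_le)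
  have loc: "bilin I (K l) v v \<le> (mv I H v l)\<^sup>2 / mv I H x l" if l: "l \<in> I" for l v
  proof -
    have Kx: "bilin I (K l) v x = mv I H v l" for v
      unfolding bilin_def mv_def[of I H] by (intro sum.cong refl) (simp add: row l)
    have ge: "0 \<le> mv I H x l"
      unfolding mv_def using l nonneg x by (intro sum_nonneg mult_nonneg_nonneg) (auto intro: less_imp_le)
    have ineq: "mv I H x l * bilin I (K l) v v \<le> (mv I H v l)\<^sup>2"
      using K(1)[OF l] ge bilin_commute[OF K(2)[OF l], of v x]
      unfolding hyperbolic_on_def by (metis Kx)
    show ?thesis
    proof (cases "mv I H x l = 0")
      \<comment> \<open>The quotient is 0 by convention here, so the form must vanish. Indeed
        \<open>K l\<close> is zero: its entries are nonnegative and each row pairs to 0 with the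
        positive vector \<open>x\<close>.\<close>
      case True
      have "K l i j = 0" if ij: "i \<in> I" "j \<in> I" for i j
      proof -
        have "\<forall>i\<in>I. H l i * x i = 0"
          using True fin l nonneg x unfolding mv_def
          by (subst (asm) sum_nonneg_eq_0_iff) (auto intro!: mult_nonneg_nonneg intro: less_imp_le)
        then have "mv I (K l) x i = 0" using row[OF l ij(1)] ij x[OF ij(1)] by auto
        then have "\<forall>j\<in>I. K l i j * x j = 0"
          using fin l x K(3) ij unfolding mv_def
          by (subst (asm) sum_nonneg_eq_0_iff) (auto intro!: mult_nonneg_nonneg intro: less_imp_le)
        then show ?thesis using ij x[OF ij(2)] by auto
      qed
      then show ?thesis using True by (simp add: bilin_def mv_def)
    next
      case False
      then show ?thesis using ge ineq by (simp add: field_simps)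
    qed
  qed
  have sq: "bilin I H v v \<le> (\<Sum>i\<in>I. x i * (mv I H v i)\<^sup>2 / mv I H x i)" for v
  proof -
    have "bilin I H v v = (\<Sum>i\<in>I. \<Sum>j\<in>I. \<Sum>l\<in>I. x l * (v i * (K l i j * v j)))"
      unfolding bilin_def mv_def sum_distrib_left
      by (intro sum.cong refl) (simp add: H sum_distrib_left sum_distrib_right mult_ac)
    also have "\<dots> = (\<Sum>i\<in>I. \<Sum>l\<in>I. \<Sum>j\<in>I. x l * (v i * (K l i j * v j)))"
      by (intro sum.cong refl sum.swap)
    also have "\<dots> = (\<Sum>l\<in>I. \<Sum>i\<in>I. \<Sum>j\<in>I. x l * (v i * (K l i j * v j)))" by (rule sum.swap)
    also have "\<dots> = (\<Sum>l\<in>I. x l * bilin I (K l) v v)"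
      by (simp add: bilin_def mv_def sum_distrib_left)
    also have "\<dots> \<le> (\<Sum>l\<in>I. x l * ((mv I H v l)\<^sup>2 / mv I H x l))"
      using loc x by (intro sum_mono mult_left_mono) (auto intro: less_imp_le)
    finally show ?thesis by simp
  qed
  show "bilin I H v v \<le> 0" if "bilin I H v x = 0" for v
    using bilin_nonpos_on_complement[of I o' H x v, OF fin o sym x nonneg star sq that] .
qed


subsection \<open>Word sums\<close>

lemma sum_equiv_pairs:
  fixes y :: "'a \<Rightarrow> real"
  assumes "equiv A r" "finite A"
  shows "(\<Sum>i\<in>A. \<Sum>j\<in>A. if (i, j) \<in> r then y i * y j else 0) = (\<Sum>K\<in>A // r. (\<Sum>i\<in>K. y i)\<^sup>2)"
proof -
  have "(\<Sum>i\<in>\<Union>(A // r). \<Sum>j\<in>A. if (i, j) \<in> r then y i * y j else 0) =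
      (\<Sum>K\<in>A // r. \<Sum>i\<in>K. \<Sum>j\<in>A. if (i, j) \<in> r then y i * y j else 0)"
    using quotient_disj[OF assms(1)] finite_equiv_class[OF assms(2) equiv_type[OF assms(1)]]
    by (subst sum.Union_disjoint) (blast, blast, simp)
  also have "\<dots> = (\<Sum>K\<in>A // r. (\<Sum>i\<in>K. y i)\<^sup>2)"
  proof (intro sum.cong refl)
    fix K assume K: "K \<in> A // r"
    have "(\<Sum>j\<in>A. if (i, j) \<in> r then y i * y j else 0) = (\<Sum>j\<in>K. y i * y j)" if "i \<in> K" for i
    proof -
      have "{j \<in> A. (i, j) \<in> r} = K"
        using that in_quotient_imp_closed[OF assms(1) K that]
          in_quotient_imp_in_rel[OF assms(1) K] in_quotient_imp_subset[OF assms(1) K] by blast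
      then show ?thesis using assms(2) by (simp flip: sum.inter_filter)
    qed
    then show "(\<Sum>i\<in>K. \<Sum>j\<in>A. if (i, j) \<in> r then y i * y j else 0) = (\<Sum>i\<in>K. y i)\<^sup>2"
      by (simp add: power2_eq_square sum_product)
  qed
  finally show ?thesis using Union_quotient[OF assms(1)] by simp
qed

text \<open>Direction 0 plays the role of a homogenizing variable.\<close>

definition add_dir :: "nat \<Rightarrow> (nat \<Rightarrow> nat) \<Rightarrow> (nat \<Rightarrow> nat)" where
  "add_dir i a = (if i = 0 then a else add_unit a i)"

lemma add_dir_commute: "add_dir i (add_dir j a) = add_dir j (add_dir i a)"
  by (simp add: add_dir_def add_unit_commute)

text \<open>The sum over words of length \<open>m\<close> in the letters 0 to \<open>n\<close>,
  weighted by the product of \<open>x\<close> over the letters. It is a homogeneous polynomial in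
  \<open>x\<close> of degree \<open>m\<close>; its derivative in direction \<open>i\<close> is
  \<open>m\<close> times the sum of length \<open>m - 1\<close> at
  \<open>add_dir i a\<close>.\<close>

primrec ext_sum ::
  "nat \<Rightarrow> (nat \<Rightarrow> real) \<Rightarrow> nat \<Rightarrow> ((nat \<Rightarrow> nat) \<Rightarrow> real) \<Rightarrow> (nat \<Rightarrow> nat) \<Rightarrow> real" where
  "ext_sum n x 0 g a = g a"
| "ext_sum n x (Suc m) g a = (\<Sum>l\<in>{0..n}. x l * ext_sum n x m g (add_dir l a))"

text \<open>The Hessian in \<open>x\<close> of \<open>ext_sum n x (m + 2) g a\<close>, divided by
  \<open>(m + 2) * (m + 1)\<close>.\<close>

definition hess ::
  "nat \<Rightarrow> (nat \<Rightarrow> real) \<Rightarrow> nat \<Rightarrow> ((nat \<Rightarrow> nat) \<Rightarrow> real) \<Rightarrow> (nat \<Rightarrow> nat) \<Rightarrow> nat \<Rightarrow> nat \<Rightarrow> real" where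
  "hess n x m g a i j = ext_sum n x m g (add_dir i (add_dir j a))"

lemma sym_matrix_hess: "sym_matrix I (hess n x m g a)"
  by (simp add: sym_matrix_def hess_def add_dir_commute)

lemma add_dir_rotate:
  "add_dir l (add_dir i (add_dir j a)) = add_dir i (add_dir j (add_dir l a))"
  by (simp only: add_dir_commute[of l i "add_dir j a"] add_dir_commute[of l j a])

text \<open>Euler's relation for second derivatives. Together with \<open>mv_hess\<close> it
  provides the assumptions \<open>H\<close> and \<open>row\<close> of
  \<open>hyperbolic_local_to_global\<close>.\<close>

lemma hess_Suc: "hess n x (Suc m) g a i j = (\<Sum>l\<in>{0..n}. x l * hess n x m g (add_dir l a) i j)"
  unfolding hess_def ext_sum.simps
  by (intro sum.cong refl) (simp only: add_dir_rotate[of _ i j])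

lemma mv_hess: "mv {0..n} (hess n x m g (add_dir l a)) x i = hess n x (Suc m) g a l i"
  unfolding mv_def hess_def ext_sum.simps
  by (intro sum.cong refl) (simp only: add_dir_rotate[of i _ l] mult.commute)

text \<open>Peeling off the last letter modifies \<open>g\<close> and keeps \<open>a\<close>, so
  that an induction can stay at the zero vector.\<close>

lemma ext_sum_Suc_inner:
  "ext_sum n x (Suc m) g a = ext_sum n x m (\<lambda>b. \<Sum>l\<in>{0..n}. x l * g (add_dir l b)) a"
proof (induction m arbitrary: a)
  case (Suc m)
  show ?case by (subst ext_sum.simps(2), subst Suc.IH, subst ext_sum.simps(2), rule refl)
qed simp

lemma continuous_on_ext_sum:
  assumes "\<And>l. l \<in> {0..n} \<Longrightarrow> continuous_on S (\<lambda>s. x s l)"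
  shows "continuous_on S (\<lambda>s. ext_sum n (x s) m g a)"
proof (induction m arbitrary: a)
  case (Suc m)
  then show ?case
    unfolding ext_sum.simps using assms by (intro continuous_on_sum continuous_on_mult) blast+
qed simp

section \<open>Effect of adding unit vectors, and counting words\<close>

lemma add_unit_nat_vecs: "a \<in> nat_vecs n \<Longrightarrow> i \<in> {1..n} \<Longrightarrow> add_unit a i \<in> nat_vecs n"
  by (auto simp: nat_vecs_def add_unit_def)

lemma add_dir_nat_vecs: "a \<in> nat_vecs n \<Longrightarrow> i \<in> {0..n} \<Longrightarrow> add_dir i a \<in> nat_vecs n"
  by (auto simp: add_dir_def intro!: add_unit_nat_vecs)

lemma vec_size_add_dir: "i \<in> {0..n} \<Longrightarrow> vec_size n (add_dir i a) \<le> vec_size n a + 1"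
  by (auto simp: add_dir_def vec_size_add_unit)

lemma finite_size_level: "finite {a \<in> nat_vecs n. vec_size n a = m}"
proof (rule finite_subset)
  show "finite {a. \<forall>i. (i \<in> {1..n} \<longrightarrow> a i \<in> {0..m}) \<and> (i \<notin> {1..n} \<longrightarrow> a i = (0::nat))}"
    by (rule finite_set_of_finite_funs) auto
  have "a i \<le> vec_size n a" if "i \<in> {1..n}" for a :: "nat \<Rightarrow> nat" and i
    unfolding vec_size_def using that by (intro member_le_sum) auto
  then show "{a \<in> nat_vecs n. vec_size n a = m} \<subseteq>
      {a. \<forall>i. (i \<in> {1..n} \<longrightarrow> a i \<in> {0..m}) \<and> (i \<notin> {1..n} \<longrightarrow> a i = (0::nat))}"
    by (auto simp: nat_vecs_def)
qed

lemma vec_pi_add_unit: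
  assumes "i \<in> {1..n}"
  shows "vec_pi n (add_unit a i) = vec_pi n a + a i"
proof -
  have "vec_pi n (add_unit a i) = (\<Sum>j=1..n. (a j choose 2) + (if j = i then a i else 0))"
    unfolding vec_pi_def add_unit_def by (rule sum.cong) (auto simp: numeral_2_eq_2)
  then show ?thesis using assms by (simp add: sum.distrib vec_pi_def)
qed

lemma vec_weight_add_unit:
  assumes "i \<in> {1..n}"
  shows "vec_weight n \<omega> (add_unit a i) = vec_weight n \<omega> a * \<omega> i"
proof -
  have "vec_weight n \<omega> (add_unit a i) = (\<Prod>j=1..n. \<omega> j ^ a j * (if j = i then \<omega> i else 1))"
    unfolding vec_weight_def add_unit_def by (rule prod.cong) auto
  then show ?thesis using assms by (simp add: prod.distrib vec_weight_def)
qed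

lemma vec_fact_add_unit:
  assumes "i \<in> {1..n}"
  shows "vec_fact n (add_unit a i) = vec_fact n a * (a i + 1)"
proof -
  have "vec_fact n (add_unit a i) = (\<Prod>j=1..n. fact (a j) * (if j = i then a i + 1 else 1))"
    unfolding vec_fact_def add_unit_def by (rule prod.cong) auto
  then show ?thesis using assms by (simp add: prod.distrib vec_fact_def)
qed

text \<open>A vector a of size m is spelled by m!/a! words in the letters 1 to n.\<close>

lemma ext_sum_zero_vec:
  assumes "x 0 = 0" "\<And>l. l \<in> {1..n} \<Longrightarrow> x l = 1"
  shows "ext_sum n x m g (\<lambda>_. 0) =
    fact m * (\<Sum>a | a \<in> nat_vecs n \<and> vec_size n a = m. g a / real (vec_fact n a))"
proof (induction m arbitrary: g)
  case 0
  have "{a \<in> nat_vecs n. vec_size n a = 0} = {\<lambda>_. 0}"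
    by (auto simp: nat_vecs_def vec_size_def fun_eq_iff) (metis atLeastAtMost_iff One_nat_def)
  then show ?case by (simp add: vec_fact_def)
next
  case (Suc m)
  define V where "V m = {a \<in> nat_vecs n. vec_size n a = m}" for m
  have one: "(\<Sum>l\<in>{0..n}. x l * g (add_dir l b)) = (\<Sum>l=1..n. g (add_unit b l))" for b
    using assms by (simp add: sum.atLeast_Suc_atMost add_dir_def)
  \<comment> \<open>Putting b = a + e_i turns 1/a! into b_i/b!, and vectors with b_i = 0 contribute
    nothing. Summed over i, the factors b_i give m + 1.\<close>
  have shift: "(\<Sum>a\<in>V m. g (add_unit a i) / real (vec_fact n a)) =
      (\<Sum>b\<in>V (Suc m). real (b i) * (g b / real (vec_fact n b)))" if i: "i \<in> {1..n}" for i
  proof -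
    have "(\<Sum>a\<in>V m. g (add_unit a i) / real (vec_fact n a)) =
        (\<Sum>b\<in>{b \<in> V (Suc m). 0 < b i}. real (b i) * (g b / real (vec_fact n b)))"
    proof (rule sum.reindex_bij_witness[where i = "\<lambda>b. b(i := b i - 1)" and j = "\<lambda>a. add_unit a i"])
      fix a assume a: "a \<in> V m"
      show "(add_unit a i)(i := add_unit a i i - 1) = a" by (auto simp: add_unit_def)
      show "add_unit a i \<in> {b \<in> V (Suc m). 0 < b i}"
        using a i by (auto simp: V_def vec_size_add_unit intro!: add_unit_nat_vecs) (simp add: add_unit_def)
      have "real (vec_fact n (add_unit a i)) = real (vec_fact n a) * real (add_unit a i i)"
        unfolding vec_fact_add_unit[OF i] by (simp add: add_unit_def algebra_simps)
      moreover have "add_unit a i i \<noteq> 0" by (simp add: add_unit_def)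
      ultimately show "real (add_unit a i i) * (g (add_unit a i) / real (vec_fact n (add_unit a i))) =
          g (add_unit a i) / real (vec_fact n a)"
        by simp
    next
      fix b assume b: "b \<in> {b \<in> V (Suc m). 0 < b i}"
      then show eq: "add_unit (b(i := b i - 1)) i = b" by (auto simp: add_unit_def)
      have "vec_size n (b(i := b i - 1)) + 1 = vec_size n b"
        using vec_size_add_unit[OF i, of "b(i := b i - 1)"] eq by simp
      then show "b(i := b i - 1) \<in> V m" using b by (auto simp: V_def nat_vecs_def)
    qed
    also have "\<dots> = (\<Sum>b\<in>V (Suc m). real (b i) * (g b / real (vec_fact n b)))"
      using finite_size_level[of n "Suc m"] by (intro sum.mono_neutral_left) (auto simp: V_def)
    finally show ?thesis .
  qed
  have "ext_sum n x (Suc m) g (\<lambda>_. 0) = ext_sum n x m (\<lambda>b. \<Sum>l=1..n. g (add_unit b l)) (\<lambda>_. 0)"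
    by (simp only: ext_sum_Suc_inner one)
  also have "\<dots> = fact m * (\<Sum>a\<in>V m. \<Sum>i=1..n. g (add_unit a i) / real (vec_fact n a))"
    unfolding Suc.IH by (simp add: V_def sum_divide_distrib)
  also have "(\<Sum>a\<in>V m. \<Sum>i=1..n. g (add_unit a i) / real (vec_fact n a)) =
      (\<Sum>i=1..n. \<Sum>b\<in>V (Suc m). real (b i) * (g b / real (vec_fact n b)))"
    by (subst sum.swap) (intro sum.cong refl shift)
  also have "\<dots> = (\<Sum>b\<in>V (Suc m). \<Sum>i=1..n. real (b i) * (g b / real (vec_fact n b)))"
    by (rule sum.swap)
  also have "\<dots> = (\<Sum>b\<in>V (Suc m). real (Suc m) * (g b / real (vec_fact n b)))"
  proof (intro sum.cong refl)
    fix b assume "b \<in> V (Suc m)"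
    then have "(\<Sum>i=1..n. real (b i)) = real (Suc m)"
      by (simp add: V_def vec_size_def flip: of_nat_sum)
    then show "(\<Sum>i=1..n. real (b i) * (g b / real (vec_fact n b))) =
        real (Suc m) * (g b / real (vec_fact n b))"
      by (simp only: sum_distrib_right[symmetric])
  qed
  also have "fact m * \<dots> = fact (Suc m) * (\<Sum>b\<in>V (Suc m). g b / real (vec_fact n b))"
    unfolding sum_distrib_left[symmetric] by simp
  finally show ?case by (simp add: V_def)
qed

section \<open>Word sums on a polymatroid\<close>

context discrete_polymatroid
begin

lemma add_unit_notin: "a \<in> nat_vecs n \<Longrightarrow> a \<notin> J \<Longrightarrow> add_unit a i \<notin> J"
proof -
  have "a \<le> add_unit a i" by (auto simp: le_fun_def add_unit_def)
  then show "a \<in> nat_vecs n \<Longrightarrow> a \<notin> J \<Longrightarrow> add_unit a i \<notin> J"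
    using hereditary by blast
qed

lemma add_dir_notin: "a \<in> nat_vecs n \<Longrightarrow> a \<notin> J \<Longrightarrow> add_dir i a \<notin> J"
  by (simp add: add_dir_def add_unit_notin)

text \<open>The word consisting of zeros stays at \<open>a\<close> and has positive weight, while by
  heredity no extension of a vector outside \<open>J\<close> lies in \<open>J\<close>.\<close>

lemma ext_sum_supported:
  assumes "\<And>i. i \<in> {0..n} \<Longrightarrow> 0 < x i" "\<And>a. a \<in> J \<Longrightarrow> 0 < g a" "\<And>a. a \<notin> J \<Longrightarrow> g a = 0"
    and "a \<in> nat_vecs n"
  shows "(a \<in> J \<longrightarrow> 0 < ext_sum n x m g a) \<and> (a \<notin> J \<longrightarrow> ext_sum n x m g a = 0)"
  using assms(4)
proof (induction m arbitrary: a)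
  case 0
  then show ?case using assms(2,3) by simp
next
  case (Suc m)
  have IH: "0 < ext_sum n x m g (add_dir l a) \<or> ext_sum n x m g (add_dir l a) = 0" if "l \<in> {0..n}" for l
    using Suc.IH[of "add_dir l a"] add_dir_nat_vecs[OF Suc.prems that] by auto
  show ?case
  proof (intro conjI impI)
    assume "a \<in> J"
    then have "0 < x 0 * ext_sum n x m g (add_dir 0 a)"
      using Suc.IH[OF Suc.prems] assms(1) by (simp add: add_dir_def)
    moreover have "0 \<le> x l * ext_sum n x m g (add_dir l a)" if "l \<in> {0..n}" for l
      using IH[OF that] assms(1)[OF that] by (auto intro: less_imp_le)
    ultimately show "0 < ext_sum n x (Suc m) g a"
      unfolding ext_sum.simps by (intro sum_pos2[where i = 0]) auto
  next
    assume "a \<notin> J"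
    then show "ext_sum n x (Suc m) g a = 0"
      using Suc add_dir_notin add_dir_nat_vecs by (simp add: sum.neutral)
  qed
qed

text \<open>Each letter raises the size by at most 1, so the bound by \<open>r\<close> survives the
  induction and the base case is consulted only up to size \<open>r\<close>. Outside
  \<open>J\<close> the matrix is zero.\<close>

lemma hyperbolic_hess:
  assumes x: "\<And>i. i \<in> {0..n} \<Longrightarrow> 0 < x i"
    and g: "\<And>a. a \<in> J \<Longrightarrow> 0 < g a" "\<And>a. a \<notin> J \<Longrightarrow> g a = 0"
    and base: "\<And>a. a \<in> J \<Longrightarrow> vec_size n a \<le> r \<Longrightarrow> hyperbolic_on {0..n} (hess n x 0 g a)"
    and "a \<in> nat_vecs n" "vec_size n a + m \<le> r"
  shows "hyperbolic_on {0..n} (hess n x m g a)"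
  using assms(5,6)
proof (induction m arbitrary: a)
  case 0
  show ?case
  proof (cases "a \<in> J")
    case False
    have "hess n x 0 g a i j = 0" if "i \<in> {0..n}" "j \<in> {0..n}" for i j
      using that 0 False g by (simp add: hess_def add_dir_notin add_dir_nat_vecs)
    then show ?thesis by (simp add: hyperbolic_on_def bilin_def mv_def)
  qed (use base 0 in auto)
next
  case (Suc m)
  have supp: "(b \<in> J \<longrightarrow> 0 < ext_sum n x m g b) \<and> (b \<notin> J \<longrightarrow> ext_sum n x m g b = 0)"
    if "b \<in> nat_vecs n" for b m
    using ext_sum_supported[of x g b m] x g that by blast
  have nv: "add_dir i (add_dir j b) \<in> nat_vecs n"
    if "b \<in> nat_vecs n" "i \<in> {0..n}" "j \<in> {0..n}" for i j b
    using that add_dir_nat_vecs by blast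
  \<comment> \<open>Entry (0, \<open>i\<close>) is the word sum at \<open>add_dir i a\<close>. It
    vanishes only if that vector is outside \<open>J\<close>, and then so are all its
    extensions.\<close>
  have star: "hess n x (Suc m) g a i j = 0"
    if ij: "i \<in> {0..n}" "j \<in> {0..n}" and z: "hess n x (Suc m) g a 0 i = 0" for i j
  proof -
    have "add_dir i a \<notin> J"
      using z supp[of "add_dir i a" "Suc m"] add_dir_nat_vecs[OF Suc.prems(1) ij(1)]
      by (auto simp: hess_def add_dir_def[of 0] simp del: ext_sum.simps)
    then have "add_dir j (add_dir i a) \<notin> J"
      using add_dir_notin add_dir_nat_vecs[OF Suc.prems(1) ij(1)] by blast
    then show ?thesis
      using supp[OF nv[OF Suc.prems(1) ij], of "Suc m"] add_dir_commute[of i j a]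
      by (simp add: hess_def del: ext_sum.simps)
  qed
  show ?case
  proof (rule hyperbolic_local_to_global[where x = x and o' = 0 and
        K = "\<lambda>l. hess n x m g (add_dir l a)"])
    fix l assume l: "l \<in> {0..n}"
    show "hyperbolic_on {0..n} (hess n x m g (add_dir l a))"
      using Suc.prems vec_size_add_dir[OF l, of a] by (intro Suc.IH add_dir_nat_vecs l) auto
    fix i j assume ij: "i \<in> {0..n}" "j \<in> {0..n}"
    show "0 \<le> hess n x m g (add_dir l a) i j"
      using supp[OF nv[OF add_dir_nat_vecs[OF Suc.prems(1) l] ij], of m]
      by (cases "add_dir i (add_dir j (add_dir l a)) \<in> J") (auto simp: hess_def)
  qed (fact x star | simp add: sym_matrix_hess hess_Suc | simp only: mv_hess)+
qed

end


subsection \<open>The base case and the inequality\<close>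

text \<open>Serves two limits: the weight of direction 0 tending to 0, and \<open>t\<close> tending
  to 0.\<close>

lemma nonneg_at_zero:
  fixes f :: "real \<Rightarrow> real"
  assumes "continuous_on UNIV f" and "\<And>s. 0 < s \<Longrightarrow> s \<le> 1 \<Longrightarrow> 0 \<le> f s"
  shows "0 \<le> f 0"
proof (rule tendsto_lowerbound)
  show "(f \<longlongrightarrow> f 0) (at_right 0)"
    using assms(1) by (auto simp: continuous_on_def intro: tendsto_within_subset)
  show "\<forall>\<^sub>F s in at_right 0. 0 \<le> f s"
    using assms(2) by (auto simp: eventually_at_right_field intro!: exI[of _ 1])
qed simp

section \<open>The quadratic form attached to the classes of Par(a)\<close>

context discrete_polymatroid
begin

lemma finite_Cont: "finite (Cont n J a)"
  by (simp add: Cont_def)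

lemma finite_Par: "finite (Par n J a)"
  unfolding Par_def using equiv_par_rel by (intro finite_quotient finite_Cont) (simp add: equiv_type)

text \<open>Exchange from a + e_j towards a + 2e_i can only add e_i, so a + e_i + e_j lies in
  \<open>J\<close> and \<open>j\<close> is not related to \<open>i\<close>.\<close>

lemma par_class_singleton:
  assumes i: "i \<in> Cont n J a" and ii: "add_unit (add_unit a i) i \<in> J"
  shows "par_rel n J a `` {i} = {i}"
proof -
  have "j = i" if ij: "(i, j) \<in> par_rel n J a" for j
  proof (rule ccontr)
    assume ne: "j \<noteq> i"
    have j: "j \<in> Cont n J a" "add_unit (add_unit a i) j \<notin> J"
      using ij ne by (auto simp: par_rel_def)
    have "vec_size n (add_unit a j) < vec_size n (add_unit (add_unit a i) i)"
      using i j by (simp add: vec_size_add_unit Cont_def)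
    then obtain l where l: "add_unit a j l < add_unit (add_unit a i) i l"
        "add_unit (add_unit a j) l \<in> J"
      using exchange[of "add_unit a j" "add_unit (add_unit a i) i"] j ii by (auto simp: Cont_def)
    have "l = i" using l(1) by (auto simp: add_unit_def split: if_splits)
    then show False using l(2) j(2) add_unit_commute[of a i j] by simp
  qed
  moreover have "(i, i) \<in> par_rel n J a" using i by (simp add: par_rel_def)
  ultimately show ?thesis by blast
qed

text \<open>The form is the full square, minus the squares of the class sums, plus \<open>t\<close>
  times the squares over the indices that can be added twice. Each of these indices is a class of
  its own, so the last part is at most \<open>t\<close> times the sum over all classes.\<close>

lemma par_form_le:
  fixes y :: "nat \<Rightarrow> real"
  assumes t: "0 \<le> t"
  shows "(\<Sum>i\<in>Cont n J a. \<Sum>j\<in>Cont n J a. if add_unit (add_unit a i) j \<in> J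
        then (if i = j then t else 1) * (y i * y j) else 0) \<le>
    (\<Sum>i\<in>Cont n J a. y i)\<^sup>2 - (1 - t) * (\<Sum>K\<in>Par n J a. (\<Sum>i\<in>K. y i)\<^sup>2)"
proof -
  let ?C = "Cont n J a" and ?r = "par_rel n J a"
  let ?Q = "\<Sum>K\<in>Par n J a. (\<Sum>i\<in>K. y i)\<^sup>2"
  define D where "D = {i \<in> ?C. add_unit (add_unit a i) i \<in> J}"
  have "(\<Sum>i\<in>D. (y i)\<^sup>2) = (\<Sum>K\<in>(\<lambda>i. {i}) ` D. (\<Sum>i\<in>K. y i)\<^sup>2)"
    by (subst sum.reindex) (auto simp: inj_on_def)
  also have "\<dots> \<le> ?Q"
  proof (rule sum_mono2[OF finite_Par])
    show "(\<lambda>i. {i}) ` D \<subseteq> Par n J a"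
    proof
      fix K assume "K \<in> (\<lambda>i. {i}) ` D"
      then obtain i where "i \<in> ?C" "add_unit (add_unit a i) i \<in> J" "K = {i}"
        by (auto simp: D_def)
      then show "K \<in> Par n J a"
        unfolding Par_def using quotientI[of i ?C ?r] par_class_singleton[of i a] by simp
    qed
  qed simp
  finally have D_le: "t * (\<Sum>i\<in>D. (y i)\<^sup>2) \<le> t * ?Q" using t by (rule mult_left_mono)
  \<comment> \<open>Subtracting the related pairs removes the whole diagonal; the last term restores
    it on \<open>D\<close> with factor \<open>t\<close>.\<close>
  have "(\<Sum>i\<in>?C. \<Sum>j\<in>?C. if add_unit (add_unit a i) j \<in> J
        then (if i = j then t else 1) * (y i * y j) else 0) =
      (\<Sum>i\<in>?C. \<Sum>j\<in>?C. y i * y j - (if (i, j) \<in> ?r then y i * y j else 0) +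
        (if j = i then (if i \<in> D then t * (y i)\<^sup>2 else 0) else 0))"
    by (intro sum.cong refl) (auto simp: par_rel_def D_def power2_eq_square)
  also have "\<dots> = (\<Sum>i\<in>?C. y i)\<^sup>2 - ?Q + (\<Sum>i\<in>?C. if i \<in> D then t * (y i)\<^sup>2 else 0)"
    using sum_equiv_pairs[OF equiv_par_rel finite_Cont, of a y]
    by (simp add: sum.distrib sum_subtractf sum_product power2_eq_square finite_Cont Par_def)
  also have "(\<Sum>i\<in>?C. if i \<in> D then t * (y i)\<^sup>2 else 0) = t * (\<Sum>i\<in>D. (y i)\<^sup>2)"
    by (simp add: D_def finite_Cont sum_distrib_left flip: sum.inter_filter)
  finally show ?thesis using D_le by (simp add: algebra_simps)
qed

text \<open>With P classes, Cauchy-Schwarz bounds the square of the total by P times the sum of the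
  squared class sums. So \<open>par_form_le\<close> leaves at most the fraction (P - 1 + t)/P of
  that square, and \<open>bp\<close> lets \<open>b\<close> make up for it.\<close>

lemma scaled_par_form_le:
  fixes y :: "nat \<Rightarrow> real"
  assumes t: "0 \<le> t" "t \<le> 1" and b: "0 \<le> b"
    and bp: "b * (real (card (Par n J a)) - 1 + t) \<le> real (card (Par n J a))"
  shows "b * (\<Sum>i\<in>Cont n J a. \<Sum>j\<in>Cont n J a. if add_unit (add_unit a i) j \<in> J
        then (if i = j then t else 1) * (y i * y j) else 0) \<le> (\<Sum>i\<in>Cont n J a. y i)\<^sup>2"
    (is "b * ?T \<le> ?S\<^sup>2")
proof -
  define Q where "Q = (\<Sum>K\<in>Par n J a. (\<Sum>i\<in>K. y i)\<^sup>2)"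
  define P where "P = real (card (Par n J a))"
  have T: "?T \<le> ?S\<^sup>2 - (1 - t) * Q" unfolding Q_def by (rule par_form_le[OF t(1)])
  have S: "?S = (\<Sum>K\<in>Par n J a. \<Sum>i\<in>K. y i)"
  proof -
    have "?S = (\<Sum>i\<in>\<Union>(Par n J a). y i)"
      unfolding Par_def Union_quotient[OF equiv_par_rel] ..
    also have "\<dots> = (\<Sum>K\<in>Par n J a. \<Sum>i\<in>K. y i)"
      unfolding Par_def using quotient_disj[OF equiv_par_rel]
        finite_equiv_class[OF finite_Cont equiv_type[OF equiv_par_rel]]
      by (subst sum.Union_disjoint) (blast, blast, simp)
    finally show ?thesis .
  qed
  have SQ: "?S\<^sup>2 \<le> Q * P" unfolding S Q_def P_def by (rule sum_squared_le_sum_of_squares)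
  show ?thesis
  proof (cases "P = 0")
    case True
    then have "Par n J a = {}" using finite_Par by (simp add: P_def)
    then show ?thesis by (simp add: Par_def)
  next
    case False
    then have P: "P > 0" by (simp add: P_def)
    have "P * (b * ?T) \<le> P * (b * (?S\<^sup>2 - (1 - t) * Q))"
      using T b P by (intro mult_left_mono) auto
    also have "\<dots> = P * b * ?S\<^sup>2 - b * (1 - t) * (Q * P)" by (simp add: algebra_simps)
    also have "\<dots> \<le> P * b * ?S\<^sup>2 - b * (1 - t) * ?S\<^sup>2"
      using SQ b t by (simp add: mult_left_mono)
    also have "\<dots> = (b * (P - 1 + t)) * ?S\<^sup>2" by (simp add: algebra_simps)
    also have "\<dots> \<le> P * ?S\<^sup>2" using bp unfolding P_def by (intro mult_right_mono) auto
    finally show ?thesis using P by simp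
  qed
qed

text \<open>Here \<open>\<rho> i\<close> is the factor gained by adding e_i, and \<open>b\<close> an
  extra factor after two additions. Orthogonality to direction 0 forces \<open>v 0 = - S\<close>,
  and the form becomes \<open>F * (b * T - S\<^sup>2)\<close>.\<close>

lemma hyperbolic_hess_base:
  fixes \<rho> :: "nat \<Rightarrow> real"
  assumes a: "a \<in> J" and t: "0 \<le> t" "t \<le> 1" and b: "0 \<le> b" and F: "0 < F"
    and bp: "b * (real (card (Par n J a)) - 1 + t) \<le> real (card (Par n J a))"
    and g0: "g a = F"
    and g1: "\<And>i. i \<in> {1..n} \<Longrightarrow> g (add_unit a i) = (if add_unit a i \<in> J then F * \<rho> i else 0)"
    and g2: "\<And>i j. i \<in> {1..n} \<Longrightarrow> j \<in> {1..n} \<Longrightarrow> g (add_unit (add_unit a i) j) =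
      (if add_unit (add_unit a i) j \<in> J then b * F * \<rho> i * \<rho> j * (if i = j then t else 1) else 0)"
  shows "hyperbolic_on {0..n} (hess n x 0 g a)"
proof (rule hyperbolic_onI[where w = "\<lambda>i. if i = 0 then 1 else 0"])
  let ?H = "hess n x 0 g a"
  show sym: "sym_matrix {0..n} ?H" by (rule sym_matrix_hess)
  fix v
  define y where "y i = \<rho> i * v i" for i
  define S where "S = (\<Sum>i\<in>Cont n J a. y i)"
  define T where "T = (\<Sum>i\<in>Cont n J a. \<Sum>j\<in>Cont n J a. if add_unit (add_unit a i) j \<in> J
        then (if i = j then t else 1) * (y i * y j) else 0)"
  have split: "(\<Sum>i\<in>{0..n}. f i) = f 0 + (\<Sum>i=1..n. f i)" for f :: "nat \<Rightarrow> real"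
    by (simp add: sum.atLeast_Suc_atMost)
  have row: "(\<Sum>i=1..n. v i * g (add_unit a i)) = F * S"
  proof -
    have "(\<Sum>i=1..n. v i * g (add_unit a i)) =
        (\<Sum>i=1..n. if add_unit a i \<in> J then F * y i else 0)"
      by (intro sum.cong refl) (simp add: g1 y_def)
    also have "\<dots> = F * S"
      by (simp add: S_def Cont_def sum_distrib_left flip: sum.inter_filter)
    finally show ?thesis .
  qed
  have quad: "(\<Sum>i=1..n. \<Sum>j=1..n. v i * v j * g (add_unit (add_unit a i) j)) = b * F * T"
  proof -
    define h where "h i j = (if add_unit (add_unit a i) j \<in> J
        then (if i = j then t else 1) * (y i * y j) else 0)" for i j
    have inC: "i \<in> Cont n J a \<and> j \<in> Cont n J a"
      if "i \<in> {1..n}" "j \<in> {1..n}" "add_unit (add_unit a i) j \<in> J" for i j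
    proof -
      have "a \<in> nat_vecs n" using a subset_vecs by blast
      then show ?thesis
        using that add_unit_notin[of "add_unit a i" j] add_unit_notin[of "add_unit a j" i]
          add_unit_nat_vecs add_unit_commute[of a i j] by (auto simp: Cont_def)
    qed
    have C_sub: "Cont n J a \<subseteq> {1..n}" by (auto simp: Cont_def)
    have h0: "h i j = 0" if "i \<in> {1..n}" "j \<in> {1..n}" "i \<notin> Cont n J a \<or> j \<notin> Cont n J a" for i j
      using inC[OF that(1,2)] that(3) unfolding h_def by meson
    have "(\<Sum>i=1..n. \<Sum>j=1..n. v i * v j * g (add_unit (add_unit a i) j)) =
        (\<Sum>i=1..n. \<Sum>j=1..n. b * F * h i j)"
      by (intro sum.cong refl) (simp add: g2 h_def y_def)
    also have "\<dots> = b * F * (\<Sum>i=1..n. \<Sum>j=1..n. h i j)" by (simp add: sum_distrib_left)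
    also have "(\<Sum>i=1..n. \<Sum>j=1..n. h i j) = (\<Sum>i=1..n. \<Sum>j\<in>Cont n J a. h i j)"
    proof (rule sum.cong[OF refl])
      fix i assume "i \<in> {1..n}"
      then show "(\<Sum>j=1..n. h i j) = (\<Sum>j\<in>Cont n J a. h i j)"
        by (intro sum.mono_neutral_right C_sub ballI h0) auto
    qed
    also have "\<dots> = (\<Sum>i\<in>Cont n J a. \<Sum>j\<in>Cont n J a. h i j)"
    proof (rule sum.mono_neutral_right)
      show "\<forall>i\<in>{1..n} - Cont n J a. (\<Sum>j\<in>Cont n J a. h i j) = 0"
        using C_sub by (intro ballI sum.neutral h0) auto
    qed (use C_sub in auto)
    finally show ?thesis by (simp add: T_def h_def)
  qed
  have "bilin {0..n} ?H v (\<lambda>i. if i = 0 then 1 else 0) = (\<Sum>i\<in>{0..n}. v i * ?H i 0)"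
    by (simp add: bilin_def mv_def if_distrib[of "\<lambda>c. _ * c"] cong: if_cong)
  also have "\<dots> = F * (v 0 + S)"
    unfolding split using row by (simp add: hess_def add_dir_def g0 algebra_simps)
  finally have lin: "bilin {0..n} ?H v (\<lambda>i. if i = 0 then 1 else 0) = F * (v 0 + S)" .
  have "bilin {0..n} ?H v v = (\<Sum>i\<in>{0..n}. \<Sum>j\<in>{0..n}. v i * v j * ?H i j)"
    by (simp add: bilin_def mv_def sum_distrib_left mult_ac)
  also have "\<dots> = v 0 * v 0 * ?H 0 0 + v 0 * (\<Sum>j=1..n. v j * ?H 0 j) +
      v 0 * (\<Sum>i=1..n. v i * ?H i 0) + (\<Sum>i=1..n. \<Sum>j=1..n. v i * v j * ?H i j)"
    unfolding split by (simp add: sum.distrib sum_distrib_left mult_ac)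
  also have "\<dots> = v 0 * v 0 * F + v 0 * (F * S) + v 0 * (F * S) + b * F * T"
  proof -
    have "(\<Sum>i=1..n. \<Sum>j=1..n. v i * v j * ?H i j) = b * F * T"
      unfolding quad[symmetric]
      by (intro sum.cong refl) (simp add: hess_def add_dir_def add_unit_commute)
    moreover have "(\<Sum>i=1..n. v i * ?H i 0) = F * S" "(\<Sum>j=1..n. v j * ?H 0 j) = F * S"
      unfolding row[symmetric] by (auto intro!: sum.cong simp: hess_def add_dir_def)
    ultimately show ?thesis by (simp add: hess_def add_dir_def g0)
  qed
  finally have quad': "bilin {0..n} ?H v v = v 0 * v 0 * F + v 0 * (F * S) + v 0 * (F * S) + b * F * T" .
  show "bilin {0..n} ?H v v \<le> 0" if "bilin {0..n} ?H v (\<lambda>i. if i = 0 then 1 else 0) = 0"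
  proof -
    have v0: "v 0 = - S" using that F unfolding lin by auto
    have "b * T \<le> S\<^sup>2" unfolding S_def T_def by (rule scaled_par_form_le[OF t b bp])
    then have "F * (b * T - S\<^sup>2) \<le> 0" using F by (simp add: mult_le_0_iff)
    then show ?thesis unfolding quad' v0 by (simp add: algebra_simps power2_eq_square)
  qed
qed

section \<open>Log-concavity of word sums\<close>

lemma log_concave_of_hyperbolic_base:
  assumes g: "\<And>a. a \<in> J \<Longrightarrow> 0 < g a" "\<And>a. a \<notin> J \<Longrightarrow> g a = 0"
    and base: "\<And>x a. a \<in> J \<Longrightarrow> vec_size n a \<le> m \<Longrightarrow> hyperbolic_on {0..n} (hess n x 0 g a)"
  defines "W \<equiv> \<lambda>m. fact m * (\<Sum>a | a \<in> nat_vecs n \<and> vec_size n a = m. g a / real (vec_fact n a))"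
  shows "W m * W (m + 2) \<le> (W (m + 1))\<^sup>2"
proof -
  \<comment> \<open>Direction 0 gets weight \<open>s\<close>, positive as
    \<open>hyperbolic_hess\<close> demands. At \<open>s = 0\<close> only the letters 1 to
    \<open>n\<close> remain, and the form values at \<open>?u\<close> and \<open>?v\<close> turn
    into \<open>W\<close> at \<open>m\<close>, \<open>m + 1\<close> and
    \<open>m + 2\<close>.\<close>
  define x :: "real \<Rightarrow> nat \<Rightarrow> real" where "x s i = (if i = 0 then s else 1)" for s i
  define E where "E s a = ext_sum n (x s) m g a" for s a
  define f where "f s = (\<Sum>i=1..n. E s (add_unit (\<lambda>_. 0) i))\<^sup>2 -
    E s (\<lambda>_. 0) * (\<Sum>i=1..n. \<Sum>j=1..n. E s (add_unit (add_unit (\<lambda>_. 0) i) j))" for s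
  have z: "(\<lambda>_. 0) \<in> nat_vecs n" "vec_size n (\<lambda>_. 0) = 0"
    by (auto simp: nat_vecs_def vec_size_def)
  have cont: "continuous_on UNIV (\<lambda>s. E s a)" for a
    unfolding E_def
  proof (rule continuous_on_ext_sum)
    show "continuous_on UNIV (\<lambda>s. x s l)" for l by (cases "l = 0") (auto simp: x_def)
  qed
  have "0 \<le> f 0"
  proof (rule nonneg_at_zero)
    show "continuous_on UNIV f"
      unfolding f_def by (intro continuous_intros cont)
  next
    fix s :: real assume s: "0 < s"
    let ?H = "hess n (x s) m g (\<lambda>_. 0)"
    let ?u = "\<lambda>i::nat. if i = 0 then 1 else (0::real)" and ?v = "\<lambda>i::nat. if i = 0 then 0 else (1::real)"
    have xpos: "0 < x s i" for i using s by (simp add: x_def)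
    have hyp: "hyperbolic_on {0..n} ?H"
      by (rule hyperbolic_hess[where r = m]) (use xpos g base z in auto)
    have split: "(\<Sum>i\<in>{0..n}. h i) = h 0 + (\<Sum>i=1..n. h i)" for h :: "nat \<Rightarrow> real"
      by (simp add: sum.atLeast_Suc_atMost)
    have uu: "bilin {0..n} ?H ?u ?u = E s (\<lambda>_. 0)"
      unfolding bilin_def mv_def split by (simp add: hess_def add_dir_def E_def)
    have uv: "bilin {0..n} ?H ?u ?v = (\<Sum>i=1..n. E s (add_unit (\<lambda>_. 0) i))"
      unfolding bilin_def mv_def split by (simp add: hess_def add_dir_def E_def)
    have vv: "bilin {0..n} ?H ?v ?v = (\<Sum>i=1..n. \<Sum>j=1..n. E s (add_unit (add_unit (\<lambda>_. 0) i) j))"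
      unfolding bilin_def mv_def split by (simp add: hess_def add_dir_def E_def add_unit_commute)
    have "0 \<le> E s (\<lambda>_. 0)"
      using ext_sum_supported[of "x s" g "\<lambda>_. 0" m] xpos g z
      by (cases "(\<lambda>_. 0) \<in> J") (auto simp: E_def)
    with hyp show "0 \<le> f s"
      unfolding hyperbolic_on_def f_def by (metis uu uv vv diff_ge_0_iff_ge)
  qed
  have count: "ext_sum n (x 0) m g (\<lambda>_. 0) = W m" for m
    unfolding W_def by (rule ext_sum_zero_vec) (auto simp: x_def)
  have step: "ext_sum n (x 0) (Suc m) g a = (\<Sum>i=1..n. ext_sum n (x 0) m g (add_unit a i))" for m a
    by (simp add: sum.atLeast_Suc_atMost x_def add_dir_def)
  have "f 0 = (W (m + 1))\<^sup>2 - W m * W (m + 2)"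
    unfolding f_def E_def by (simp only: flip: step count Suc_eq_plus1 add_2_eq_Suc')
  with \<open>0 \<le> f 0\<close> show ?thesis by simp
qed

section \<open>Nonempty levels and the maximal number of classes\<close>

lemma zero_vec_in_J: "(\<lambda>_. 0) \<in> J"
proof -
  obtain a where "a \<in> J" using nonempty by blast
  then show ?thesis using hereditary[of a "\<lambda>_. 0"] by (simp add: nat_vecs_def le_fun_def)
qed

lemma exists_Cont:
  assumes "a \<in> J" "vec_size n a < rk n J"
  shows "\<exists>i. i \<in> Cont n J a"
proof -
  have "rk n J \<in> vec_size n ` J" unfolding rk_def using finite_J nonempty by (intro Max_in) auto
  then obtain b where "b \<in> J" "vec_size n b = rk n J" by auto
  then show ?thesis using exchange[of a b] assms by (auto simp: Cont_def)
qed

lemma level_nonempty: "m \<le> rk n J \<Longrightarrow> level n J m \<noteq> {}"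
proof (induction m)
  case 0
  then show ?case using zero_vec_in_J by (auto simp: level_def vec_size_def)
next
  case (Suc m)
  then obtain a where "a \<in> J" "vec_size n a = m" by (auto simp: level_def)
  with Suc.prems exists_Cont[of a] obtain i where "i \<in> {1..n}" "add_unit a i \<in> J"
    by (auto simp: Cont_def)
  then have "add_unit a i \<in> level n J (Suc m)"
    using \<open>vec_size n a = m\<close> by (simp add: level_def vec_size_add_unit)
  then show ?case by blast
qed

lemma finite_level: "finite (level n J m)"
  using finite_J by (simp add: level_def)

lemma card_Par_le_max_par: "a \<in> level n J m \<Longrightarrow> card (Par n J a) \<le> max_par n J m"
  unfolding max_par_def by (intro Max_ge) (auto simp: finite_level)

lemma max_par_pos:
  assumes "m < rk n J"
  shows "1 \<le> max_par n J m"
proof -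
  obtain a where a: "a \<in> level n J m" using level_nonempty[of m] assms by auto
  then obtain i where "i \<in> Cont n J a" using exists_Cont[of a] assms by (auto simp: level_def)
  then have "Par n J a \<noteq> {}" by (auto simp: Par_def)
  then have "1 \<le> card (Par n J a)" using finite_Par by (simp add: Suc_le_eq card_gt_0_iff)
  then show ?thesis using card_Par_le_max_par[OF a] by simp
qed

section \<open>The inequality for level sums and its degenerate case\<close>

text \<open>Denominators are cleared so that both sides are continuous in \<open>t\<close> up to
  \<open>t = 0\<close>, even when \<open>p = 1\<close>.\<close>

lemma level_sum_ineq_pos:
  assumes \<omega>: "\<And>i. i \<in> {1..n} \<Longrightarrow> \<omega> i > 0" and t: "0 < t" "t \<le> 1" and m: "m < rk n J"
  defines "p \<equiv> real (max_par n J m)"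
  shows "real (m + 2) * p * (level_sum n J \<omega> t m * level_sum n J \<omega> t (m + 2)) \<le>
    real (m + 1) * (p - 1 + t) * (level_sum n J \<omega> t (m + 1))\<^sup>2"
proof -
  have p: "1 \<le> p" using max_par_pos[OF m] by (simp add: p_def)
  \<comment> \<open>The largest factor that \<open>scaled_par_form_le\<close> admits for
    \<open>p\<close> classes; it is also admissible for fewer classes.\<close>
  define c where "c = p / (p - 1 + t)"
  have den: "0 < p - 1 + t" using p t by simp
  have c: "0 < c" using p den by (simp add: c_def)
  define F where "F a = t ^ vec_pi n a * vec_weight n \<omega> a" for a
  define C where "C a = (if vec_size n a = m + 2 then c else 1)" for a
  define g where "g a = (if a \<in> J then C a * F a else 0)" for a
  have F: "0 < F a" for a
    unfolding F_def vec_weight_def using t \<omega> by (intro mult_pos_pos prod_pos) auto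
  \<comment> \<open>The exponent of \<open>t\<close> grows by the current entry \<open>a i\<close>,
    so adding e_i a second time costs one more factor \<open>t\<close>: the diagonal weight of the
    form.\<close>
  have F1: "F (add_unit a i) = F a * (\<omega> i * t ^ a i)" if "i \<in> {1..n}" for a i
    using that by (simp add: F_def vec_pi_add_unit vec_weight_add_unit power_add)
  \<comment> \<open>Only from level \<open>m\<close> do two additions reach the scaled level
    \<open>m + 2\<close>; from lower levels the factor is 1.\<close>
  have base: "hyperbolic_on {0..n} (hess n x 0 g a)" if a: "a \<in> J" "vec_size n a \<le> m" for x a
  proof (rule hyperbolic_hess_base[where \<rho> = "\<lambda>i. \<omega> i * t ^ a i"
        and b = "if vec_size n a = m then c else 1"])
    let ?q = "real (card (Par n J a))"
    show "(if vec_size n a = m then c else 1) * (?q - 1 + t) \<le> ?q"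
    proof (cases "vec_size n a = m")
      case True
      then have "?q \<le> p"
        using card_Par_le_max_par[of a m] a by (simp add: p_def level_def)
      then have "?q * (1 - t) \<le> p * (1 - t)" using t by (intro mult_right_mono) auto
      then have "p * (?q - 1 + t) \<le> ?q * (p - 1 + t)" by (simp add: algebra_simps)
      then show ?thesis using True den by (simp add: c_def field_simps)
    qed (use t in simp)
    show "g a = F a" using a by (simp add: g_def C_def)
    show "g (add_unit a i) = (if add_unit a i \<in> J then F a * (\<omega> i * t ^ a i) else 0)"
      if "i \<in> {1..n}" for i
      using a that by (simp add: g_def C_def vec_size_add_unit F1)
    show "g (add_unit (add_unit a i) j) = (if add_unit (add_unit a i) j \<in> J then
        (if vec_size n a = m then c else 1) * F a * (\<omega> i * t ^ a i) * (\<omega> j * t ^ a j) *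
        (if i = j then t else 1) else 0)" if "i \<in> {1..n}" "j \<in> {1..n}" for i j
    proof -
      have "add_unit a i j = a j + (if i = j then 1 else 0)" by (simp add: add_unit_def)
      then show ?thesis using that by (simp add: g_def C_def vec_size_add_unit F1)
    qed
  qed (use a t c F in auto)
  have total: "(\<Sum>a | a \<in> nat_vecs n \<and> vec_size n a = l. g a / real (vec_fact n a)) =
      (if l = m + 2 then c else 1) * level_sum n J \<omega> t l" for l
  proof -
    have "(\<Sum>a | a \<in> nat_vecs n \<and> vec_size n a = l. g a / real (vec_fact n a)) =
        (\<Sum>a\<in>level n J l. g a / real (vec_fact n a))"
      by (rule sum.mono_neutral_right)
        (use finite_size_level subset_vecs in \<open>auto simp: level_def g_def\<close>)
    also have "\<dots> = (if l = m + 2 then c else 1) * level_sum n J \<omega> t l"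
      unfolding level_sum_def sum_distrib_left
      by (intro sum.cong refl) (simp add: level_def g_def C_def F_def)
    finally show ?thesis .
  qed
  have "fact m * level_sum n J \<omega> t m * (fact (m + 2) * (c * level_sum n J \<omega> t (m + 2))) \<le>
      (fact (m + 1) * level_sum n J \<omega> t (m + 1))\<^sup>2"
    using log_concave_of_hyperbolic_base[of g m] c F base unfolding total
    by (simp add: g_def C_def)
  \<comment> \<open>The factorials in the word sums leave the ratio (m + 2)/(m + 1), which is 1 +
    1/k for k = m + 1.\<close>
  moreover have "fact (m + 1) = real (m + 1) * fact m" "fact (m + 2) = real (m + 2) * (real (m + 1) * fact m)"
    by simp_all
  ultimately have "((fact m)\<^sup>2 * real (m + 1)) * (real (m + 2) * (c * (level_sum n J \<omega> t m * level_sum n J \<omega> t (m + 2)))) \<le>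
      ((fact m)\<^sup>2 * real (m + 1)) * (real (m + 1) * (level_sum n J \<omega> t (m + 1))\<^sup>2)"
    by (simp only: power2_eq_square mult_ac)
  then have "real (m + 2) * (c * (level_sum n J \<omega> t m * level_sum n J \<omega> t (m + 2))) \<le>
      real (m + 1) * (level_sum n J \<omega> t (m + 1))\<^sup>2"
    by (subst (asm) mult_le_cancel_left_pos) auto
  from mult_left_mono[OF this less_imp_le[OF den]]
  have "real (m + 2) * ((p - 1 + t) * c) * (level_sum n J \<omega> t m * level_sum n J \<omega> t (m + 2)) \<le>
      real (m + 1) * (p - 1 + t) * (level_sum n J \<omega> t (m + 1))\<^sup>2"
    by (simp only: mult_ac)
  moreover have "(p - 1 + t) * c = p" using den by (simp add: c_def)
  ultimately show ?thesis by simp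
qed

text \<open>At \<open>t = 0\<close> the weight vanishes on vectors with an entry above 1, so it need
  not be positive on \<open>J\<close>; this case is reached as a limit.\<close>

lemma level_sum_ineq:
  assumes \<omega>: "\<And>i. i \<in> {1..n} \<Longrightarrow> \<omega> i > 0" and t: "0 \<le> t" "t \<le> 1" and m: "m < rk n J"
  defines "p \<equiv> real (max_par n J m)"
  shows "real (m + 2) * p * (level_sum n J \<omega> t m * level_sum n J \<omega> t (m + 2)) \<le>
    real (m + 1) * (p - 1 + t) * (level_sum n J \<omega> t (m + 1))\<^sup>2"
proof (cases "t = 0")
  case True
  define f where "f t = real (m + 1) * (p - 1 + t) * (level_sum n J \<omega> t (m + 1))\<^sup>2 -
    real (m + 2) * p * (level_sum n J \<omega> t m * level_sum n J \<omega> t (m + 2))" for t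
  have "0 \<le> f 0"
  proof (rule nonneg_at_zero)
    show "continuous_on UNIV f"
      unfolding f_def level_sum_def by (intro continuous_intros)
    show "0 \<le> f s" if "0 < s" "s \<le> 1" for s
      using level_sum_ineq_pos[OF \<omega> that m] by (simp add: f_def p_def)
  qed
  then show ?thesis by (simp add: f_def True)
qed (use level_sum_ineq_pos[OF \<omega> _ t(2) m] t in \<open>simp add: p_def\<close>)

text \<open>At \<open>t = 0\<close> only vectors with entries 0 and 1 contribute. Deleting two
  support indices of such a vector gives some \<open>b\<close> at level \<open>m\<close> that both
  indices extend, separately and jointly; they lie in different classes, so \<open>b\<close> has at
  least two.\<close>

lemma level_sum_zero_of_max_par_one:
  assumes "max_par n J m = 1"
  shows "level_sum n J \<omega> 0 (m + 2) = 0"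
  unfolding level_sum_def
proof (intro sum.neutral ballI)
  fix a assume "a \<in> level n J (m + 2)"
  then have a: "a \<in> J" "vec_size n a = m + 2" by (auto simp: level_def)
  have nv: "a \<in> nat_vecs n" using a subset_vecs by blast
  have "vec_pi n a \<noteq> 0"
  proof
    assume "vec_pi n a = 0"
    have le1: "a i \<le> 1" if "i \<in> {1..n}" for i
    proof -
      have "a i choose 2 = 0" using \<open>vec_pi n a = 0\<close> that by (simp add: vec_pi_def)
      then have "a i < 2" by (simp only: binomial_eq_0_iff)
      then show ?thesis by simp
    qed
    have pick: "\<exists>i\<in>{1..n}. 0 < b i" if "0 < vec_size n b" for b
      using that by (rule contrapos_pp) (simp add: vec_size_def)
    obtain i where i: "i \<in> {1..n}" "0 < a i" using pick[of a] a by auto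
    have ai: "add_unit (a(i := 0)) i = a"
      using le1[OF i(1)] i(2) by (auto simp: add_unit_def fun_eq_iff)
    have sz: "vec_size n (a(i := 0)) = m + 1"
      using vec_size_add_unit[OF i(1), of "a(i := 0)"] a unfolding ai by simp
    then obtain j where j: "j \<in> {1..n}" "0 < (a(i := 0)) j" using pick[of "a(i := 0)"] by auto
    then have ne: "i \<noteq> j" by auto
    define b where "b = a(i := 0, j := 0)"
    have bj: "a(i := 0) = add_unit b j"
      using le1[OF j(1)] j(2) ne by (auto simp: add_unit_def fun_eq_iff b_def)
    have bi: "a(j := 0) = add_unit b i"
      using le1[OF i(1)] i(2) ne by (auto simp: add_unit_def fun_eq_iff b_def)
    have sub: "a(i := 0) \<in> J" "a(j := 0) \<in> J" "b \<in> J"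
      using nv by (auto intro!: hereditary[OF a(1)] simp: nat_vecs_def le_fun_def b_def)
    have "b \<in> level n J m"
      using sz sub vec_size_add_unit[OF j(1), of b] by (simp add: level_def bj)
    then have "card (Par n J b) \<le> 1" using card_Par_le_max_par assms by metis
    moreover have C: "i \<in> Cont n J b" "j \<in> Cont n J b"
      using i(1) j(1) sub(1,2) unfolding bi bj by (simp_all add: Cont_def)
    moreover have "(i, j) \<notin> par_rel n J b"
    proof -
      have "add_unit (add_unit b i) j = a" using ai unfolding bj by (simp add: add_unit_commute)
      then show ?thesis using ne a(1) by (simp add: par_rel_def)
    qed
    ultimately have "par_rel n J b `` {i} \<noteq> par_rel n J b `` {j}"
      using eq_equiv_class_iff[OF equiv_par_rel C] by simp
    moreover have "par_rel n J b `` {i} \<in> Par n J b" "par_rel n J b `` {j} \<in> Par n J b"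
      using C by (simp_all add: Par_def quotientI)
    ultimately show False
      using \<open>card (Par n J b) \<le> 1\<close> finite_Par[of b] by (metis One_nat_def card_le_Suc0_iff_eq)
  qed
  then show "0 ^ vec_pi n a * (vec_weight n \<omega> a / real (vec_fact n a)) = 0" by simp
qed

end

theorem theorem1p21:
  fixes n k :: nat and J :: "(nat \<Rightarrow> nat) set" and \<omega> :: "nat \<Rightarrow> real" and t :: real
  assumes "discrete_polymatroid n J"
    and "\<And>i. i \<in> {1..n} \<Longrightarrow> \<omega> i > 0"
    and "0 \<le> t" and "t \<le> 1"
    and "1 \<le> k" and "k < rk n J"
  shows "(t = 0 \<and> max_par n J (k - 1) = 1 \<longrightarrow> level_sum n J \<omega> t (k + 1) = 0) \<and>
    (level_sum n J \<omega> t k)\<^sup>2 \<ge>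
      (1 + 1 / real k) * (1 + (1 - t) / (real (max_par n J (k - 1)) - 1 + t)) *
      level_sum n J \<omega> t (k - 1) * level_sum n J \<omega> t (k + 1)"
proof -
  interpret discrete_polymatroid n J by fact
  obtain m where k: "k = m + 1" using assms(5) by (metis add.commute le_Suc_ex)
  have m: "m < rk n J" using assms(6) k by simp
  define p where "p = real (max_par n J m)"
  define L where "L = level_sum n J \<omega> t"
  have p: "1 \<le> p" using max_par_pos[OF m] by (simp add: p_def)
  have zero: "L (m + 2) = 0" if "t = 0" "p = 1"
    using that level_sum_zero_of_max_par_one[of m \<omega>] by (simp add: p_def L_def)
  have ineq: "real (m + 2) * p * (L m * L (m + 2)) \<le> real (m + 1) * (p - 1 + t) * (L (m + 1))\<^sup>2"
    using level_sum_ineq[OF assms(2-4) m] by (simp add: p_def L_def)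
  have "(1 + 1 / real (m + 1)) * (1 + (1 - t) / (p - 1 + t)) * L m * L (m + 2) \<le> (L (m + 1))\<^sup>2"
  proof (cases "p - 1 + t = 0")
    \<comment> \<open>Division by zero makes the second factor 1, and the left side vanishes because
      \<open>L (m + 2) = 0\<close>.\<close>
    case True
    then have "t = 0" "p = 1" using p assms(3) by auto
    then show ?thesis using zero by simp
  next
    case False
    then have d: "0 < p - 1 + t" using p assms(3) by simp
    have "1 + 1 / real (m + 1) = real (m + 2) / real (m + 1)" by (simp add: field_simps)
    moreover have "1 + (1 - t) / (p - 1 + t) = p / (p - 1 + t)" using d by (simp add: field_simps)
    ultimately have "(1 + 1 / real (m + 1)) * (1 + (1 - t) / (p - 1 + t)) * L m * L (m + 2) =
        (real (m + 2) * p * (L m * L (m + 2))) / (real (m + 1) * (p - 1 + t))" by simp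
    also have "\<dots> \<le> (L (m + 1))\<^sup>2"
      using ineq d by (subst pos_divide_le_eq) (auto simp: mult_ac)
    finally show ?thesis .
  qed
  then show ?thesis using zero by (simp add: k p_def L_def)
qed

end
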